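(* Let $k\ge1$ and let $G$ be a (simple) graph on $2k$ vertices such that every complete subgraph of $G$ has at most $k$ vertices. Then $G$ contains at least $\left[\frac{k+1}{2}\right]$ pairwise disjoint pairs of non-adjacent vertices. Moreover this bound is sharp: there exist such graphs in which every maximal-cardinality set of pairwise disjoint pairs of non-adjacent vertices has exactly $\left[\frac{k+1}{2}\right]$ elements.
   Context: $[x]$ denotes the integer part of $x$. Two pairs of vertices are disjoint if they share no vertex; a pair is non-adjacent (disconnected) if not joined by an edge. *)

theory Defs
  imports "Graph_Theory.Graph_Theory"
begin

text \<open>
  A finite simple graph is a \<^const>\<open>pair_graph\<close>: a finite, loop-free, symmetric relation
  \<^const>\<open>parcs\<close> on \<^const>\<open>pverts\<close>, each edge being present in both orientations.
\<close>

definition complete_subgraphs_bounded :: "'a pair_pre_digraph \<Rightarrow> nat \<Rightarrow> bool" where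
  "complete_subgraphs_bounded G k \<longleftrightarrow>
     (\<forall>H :: 'a pair_pre_digraph. \<forall>m.
        subgraph (with_proj H) (with_proj G) \<and> complete_digraph m (with_proj H) \<longrightarrow> m \<le> k)"

definition nonadjacent_pairs :: "'a pair_pre_digraph \<Rightarrow> 'a set set" where
  "nonadjacent_pairs G =
     {{u, v} | u v. u \<in> pverts G \<and> v \<in> pverts G \<and> u \<noteq> v \<and> (u, v) \<notin> parcs G}"

definition disjoint_nonadjacent_pairs :: "'a pair_pre_digraph \<Rightarrow> 'a set set \<Rightarrow> bool" where
  "disjoint_nonadjacent_pairs G M \<longleftrightarrow> M \<subseteq> nonadjacent_pairs G \<and> pairwise disjnt M"

end

theory Submission
  imports Defs
begin

text \<open>
  The vertices missed by a maximal set of \<open>m\<close> disjoint non-adjacent pairs form a clique, so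
  \<open>2 * k - 2 * m \<le> k\<close>. For sharpness take the graph whose complement is a complete graph on
  \<open>k + 1\<close> vertices together with \<open>k - 1\<close> isolated vertices: a clique contains at most one of the
  first \<open>k + 1\<close> vertices, and all non-adjacent pairs lie among those \<open>k + 1\<close> vertices.
\<close>

text \<open>Transfers the bound on complete subgraphs to vertex sets: all ordered pairs of distinct
  elements of \<open>U\<close> are arcs of \<open>G\<close>, so they make \<open>U\<close> into a
  complete subgraph \<open>H\<close>.\<close>

lemma card_clique_le:
  assumes "complete_subgraphs_bounded G k"
    and "pair_graph G" and "U \<subseteq> pverts G"
    and adj: "\<And>u v. u \<in> U \<Longrightarrow> v \<in> U \<Longrightarrow> u \<noteq> v \<Longrightarrow> (u, v) \<in> parcs G"
  shows "card U \<le> k"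
proof -
  interpret G: pair_graph G by fact
  define H where "H = \<lparr>pverts = U, parcs = {(u, v). u \<in> U \<and> v \<in> U \<and> u \<noteq> v}\<rparr>"
  have "finite U" using assms(3) G.pair_finite_verts finite_subset by blast
  have "pair_graph H"
  proof
    show "finite (pverts H)" by (simp add: H_def \<open>finite U\<close>)
    have "parcs H \<subseteq> U \<times> U" by (auto simp: H_def)
    then show "finite (parcs H)" using \<open>finite U\<close> finite_subset by blast
  qed (auto simp: H_def sym_def symmetric_def)
  then interpret H: pair_graph H .
  have "complete_digraph (card U) (with_proj H)"
    using H.graph_axioms by (auto simp: complete_digraph_def H_def)
  moreover have "subgraph (with_proj H) (with_proj G)"
    using assms(3) adj H.wf_digraph_axioms G.wf_digraph_axioms
    by (auto simp: subgraph_def H_def compatible_def)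
  ultimately show ?thesis
    using assms(1) unfolding complete_subgraphs_bounded_def by blast
qed

text \<open>Converse transfer, used to verify the extremal graph: the vertices of a complete
  subgraph on \<open>m\<close> vertices form a clique of size \<open>m\<close> in
  \<open>G\<close>.\<close>

lemma complete_subgraphs_boundedI:
  assumes "\<And>U. U \<subseteq> pverts G \<Longrightarrow>
    (\<And>u v. u \<in> U \<Longrightarrow> v \<in> U \<Longrightarrow> u \<noteq> v \<Longrightarrow> (u, v) \<in> parcs G) \<Longrightarrow> card U \<le> k"
  shows "complete_subgraphs_bounded G k"
  unfolding complete_subgraphs_bounded_def
proof (intro allI impI, elim conjE)
  fix H :: "'a pair_pre_digraph" and m
  assume sub: "subgraph (with_proj H) (with_proj G)" and complete: "complete_digraph m (with_proj H)"
  have "(u, v) \<in> parcs G" if "u \<in> pverts H" "v \<in> pverts H" "u \<noteq> v" for u v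
    using that complete sub by (auto simp: subgraph_def complete_digraph_def)
  moreover have "pverts H \<subseteq> pverts G" using sub by (simp add: subgraph_def)
  ultimately have "card (pverts H) \<le> k" using assms by blast
  then show "m \<le> k" using complete by (simp add: complete_digraph_def)
qed

text \<open>Each pair has two distinct ends and no vertex is shared. For infinite \<open>M\<close>
  both sides are 0, the default value of \<open>card\<close>.\<close>

lemma card_disjoint_nonadjacent_pairs:
  assumes "disjoint_nonadjacent_pairs G M"
  shows "2 * card M = card (\<Union>M)"
proof -
  have two: "card P = 2" if "P \<in> M" for P
    using assms(1) that by (auto simp: disjoint_nonadjacent_pairs_def nonadjacent_pairs_def)
  have "card (\<Union>M) = sum card M"
    using assms two
    by (intro card_Union_disjoint) (auto simp: disjoint_nonadjacent_pairs_def intro: card_ge_0_finite)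
  also have "\<dots> = 2 * card M" using two by simp
  finally show ?thesis by simp
qed

lemma disjoint_nonadjacent_pairs_lower_bound:
  assumes "pair_graph G" "card (pverts G) = 2 * k" "complete_subgraphs_bounded G k"
  shows "\<exists>M. disjoint_nonadjacent_pairs G M \<and> card M \<ge> (k + 1) div 2"
proof -
  interpret G: pair_graph G by fact
  have sub: "\<Union>M \<subseteq> pverts G" if "disjoint_nonadjacent_pairs G M" for M
    using that by (auto simp: disjoint_nonadjacent_pairs_def nonadjacent_pairs_def)
  then have "{M. disjoint_nonadjacent_pairs G M} \<subseteq> Pow (Pow (pverts G))" by auto
  then have "finite {M. disjoint_nonadjacent_pairs G M}"
    using G.pair_finite_verts by (meson finite_Pow_iff finite_subset)
  moreover have "disjoint_nonadjacent_pairs G {}"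
    by (simp add: disjoint_nonadjacent_pairs_def)
  \<comment> \<open>Maximality under inclusion suffices here; it exists because the family is finite
    and contains the empty set.\<close>
  ultimately obtain M where M: "disjoint_nonadjacent_pairs G M"
    and maximal: "\<And>N. disjoint_nonadjacent_pairs G N \<Longrightarrow> M \<subseteq> N \<Longrightarrow> N = M"
    using finite_has_maximal[of "{M. disjoint_nonadjacent_pairs G M}"] by auto
  define U where "U = pverts G - \<Union>M"
  have fin: "finite (\<Union>M)" using sub[OF M] G.pair_finite_verts finite_subset by blast
  have "card U \<le> k"
  proof (rule card_clique_le[OF assms(3,1)])
    fix u v assume uv: "u \<in> U" "v \<in> U" "u \<noteq> v"
    show "(u, v) \<in> parcs G"
    proof (rule ccontr)
      assume "(u, v) \<notin> parcs G"
      then have "{u, v} \<in> nonadjacent_pairs G"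
        using uv by (auto simp: U_def nonadjacent_pairs_def)
      \<comment> \<open>Both \<open>u\<close> and \<open>v\<close> lie outside \<Union>M, so the new
        pair meets no pair of \<open>M\<close>.\<close>
      then have "disjoint_nonadjacent_pairs G (insert {u, v} M)"
        using M uv
        by (auto simp: disjoint_nonadjacent_pairs_def pairwise_insert disjnt_def U_def)
      then have "{u, v} \<in> M" using maximal by blast
      then show False using uv by (auto simp: U_def)
    qed
  qed (auto simp: U_def)
  moreover have "card U = 2 * k - 2 * card M"
    using card_Diff_subset[OF fin sub[OF M]] card_disjoint_nonadjacent_pairs[OF M] assms(2)
    by (simp add: U_def)
  \<comment> \<open>The two facts give k \<le> 2 * card M, and (k + 1) div 2 is k / 2 rounded
    up.\<close>
  ultimately have "(k + 1) div 2 \<le> card M" by linarith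
  then show ?thesis using M by blast
qed

lemma disjoint_nonadjacent_pairs_sharp:
  assumes "k \<ge> 1"
  shows "\<exists>G :: nat pair_pre_digraph.
            pair_graph G \<and> card (pverts G) = 2 * k \<and> complete_subgraphs_bounded G k \<and>
            (\<forall>M. is_arg_max card (disjoint_nonadjacent_pairs G) M \<longrightarrow> card M = (k + 1) div 2)"
proof -
  \<comment> \<open>The vertices 0, ..., k are pairwise non-adjacent; each of the k - 1 vertices
    above k is joined to all others.\<close>
  define G :: "nat pair_pre_digraph" where
    "G = \<lparr>pverts = {..<2 * k}, parcs = {(u, v). u < 2 * k \<and> v < 2 * k \<and> u \<noteq> v \<and> (k < u \<or> k < v)}\<rparr>"
  have graph: "pair_graph G"
  proof
    have "parcs G \<subseteq> {..<2 * k} \<times> {..<2 * k}" by (auto simp: G_def)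
    then show "finite (parcs G)" by (rule finite_subset) simp
  qed (auto simp: G_def sym_def symmetric_def)
  have card: "card (pverts G) = 2 * k" by (simp add: G_def)
  have bounded: "complete_subgraphs_bounded G k"
  proof (rule complete_subgraphs_boundedI)
    fix U assume U: "U \<subseteq> pverts G"
      and adj: "\<And>u v. u \<in> U \<Longrightarrow> v \<in> U \<Longrightarrow> u \<noteq> v \<Longrightarrow> (u, v) \<in> parcs G"
    have "card (U \<inter> {..k}) \<le> 1"
      using adj by (fastforce simp: card_le_Suc0_iff_eq G_def)
    moreover have "card (U \<inter> {k<..<2 * k}) \<le> card {k<..<2 * k}"
      by (intro card_mono) auto
    moreover have "U = U \<inter> {..k} \<union> U \<inter> {k<..<2 * k}" using U by (auto simp: G_def)
    then have "card U \<le> card (U \<inter> {..k}) + card (U \<inter> {k<..<2 * k})"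
      by (metis card_Un_le)
    \<comment> \<open>The total is 1 + (k - 1), which equals k because k \<ge> 1.\<close>
    ultimately show "card U \<le> k" using assms by simp
  qed
  have "card M \<le> (k + 1) div 2" if "disjoint_nonadjacent_pairs G M" for M
  proof -
    \<comment> \<open>A vertex above k is adjacent to every other vertex, so it lies in no
      non-adjacent pair.\<close>
    have "\<Union>M \<subseteq> {..k}"
      using that by (fastforce simp: disjoint_nonadjacent_pairs_def nonadjacent_pairs_def G_def)
    then have "card (\<Union>M) \<le> k + 1" using card_mono[of "{..k}"] by fastforce
    then show ?thesis
      using card_disjoint_nonadjacent_pairs[OF that] by linarith
  qed
  then have "card M = (k + 1) div 2" if "is_arg_max card (disjoint_nonadjacent_pairs G) M" for M
  proof (rule antisym)
    \<comment> \<open>The general lower bound applies to \<open>G\<close> itself, and a maximizer is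
      at least as large as \<open>N\<close>.\<close>
    obtain N where "disjoint_nonadjacent_pairs G N" "card N \<ge> (k + 1) div 2"
      using disjoint_nonadjacent_pairs_lower_bound[OF graph card bounded] by blast
    then show "(k + 1) div 2 \<le> card M" using that by (force simp: is_arg_max_def)
  qed (use that in \<open>auto simp: is_arg_max_def\<close>)
  then show ?thesis using graph card bounded by blast
qed

theorem lemma3p1:
  fixes k :: nat
  assumes "k \<ge> 1"
  shows "(\<forall>G :: 'a pair_pre_digraph.
            pair_graph G \<and> card (pverts G) = 2 * k \<and> complete_subgraphs_bounded G k \<longrightarrow>
            (\<exists>M. disjoint_nonadjacent_pairs G M \<and> card M \<ge> (k + 1) div 2))
       \<and> (\<exists>G :: nat pair_pre_digraph.
            pair_graph G \<and> card (pverts G) = 2 * k \<and> complete_subgraphs_bounded G k \<and>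
            (\<forall>M. is_arg_max card (disjoint_nonadjacent_pairs G) M \<longrightarrow> card M = (k + 1) div 2))"
  using disjoint_nonadjacent_pairs_lower_bound disjoint_nonadjacent_pairs_sharp[OF assms] by blast

end
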